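(* Let $(\mathcal A,\varphi,\omega)$ be a cyclic non-commutative probability space and let $a,b\in\mathcal A$ be cyclic-Boolean independent elements. Then, as formal Laurent series in $1/z$, $$ \tilde{\mathfrak g}_{a+b}(z) = \tilde{\mathfrak g}_a(z)+\tilde{\mathfrak g}_b(z)+\frac{G_a'(z)}{G_a(z)}+\frac{G_b'(z)}{G_b(z)}-\frac{G_{a+b}'(z)}{G_{a+b}(z)}+\frac1z ; $$ that is, if for $x\in\mathcal A$ one defines $$ \mathfrak h_x(z)=\tilde{\mathfrak g}_x(z)+\frac{d}{dz}\log\bigl(zG_x(z)\bigr)=\tilde{\mathfrak g}_x(z)+\frac1z+\frac{G_x'(z)}{G_x(z)}, $$ then $\mathfrak h_{a+b}(z)=\mathfrak h_a(z)+\mathfrak h_b(z)$.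
   Context: A cyclic non-commutative probability space is a triple $(\mathcal A,\varphi,\omega)$ where $\mathcal A$ is a (not necessarily unital) $*$-algebra over $\mathbb C$, $\varphi$ is a positive linear functional on $\mathcal A$, and $\omega$ is a positive tracial linear functional on $\mathcal A$ (i.e. $\omega(xy)=\omega(yx)$). A family of $*$-subalgebras $\{\mathcal A_k\}_{k\in K}$ of $\mathcal A$ is cyclic-Boolean independent if: (i) (Boolean independence with respect to $\varphi$) for any $n\ge 2$, any alternating tuple $(k_1,\dots,k_n)\in K^n$ (consecutive entries distinct: $k_1\ne k_2\ne\cdots\ne k_n$) and $a_i\in\mathcal A_{k_i}$, one has $\varphi(a_1\cdots a_n)=\varphi(a_1)\cdots\varphi(a_n)$; (ii) for any $n\ge 2$, any cyclically alternating tuple $(k_1,\dots,k_n)\in K^n$ (i.e. $k_1\ne k_2\ne\cdots\ne k_n\ne k_1$) and $a_i\in\mathcal A_{k_i}$, one has $\omega(a_1\cdots a_n)=\varphi(a_1)\cdots\varphi(a_n)$ (for $n=1$ the value is just $\omega(a_1)$). A family of elements $\{a_k\}_{k\in K}$ is cyclic-Boolean independent if the family $\{\mathcal A_k\}_{k\in K}$ is, where $\mathcal A_k$ is the $*$-subalgebra generated by $a_k$ without unit. For $x\in\mathcal A$, the renormalized Cauchy transform and the Green function are the formal Laurent series $$\tilde{\mathfrak g}_x(z)=\sum_{n=1}^\infty\frac{\omega(x^n)}{z^{n+1}},\qquad G_x(z)=\frac1z+\sum_{n=1}^\infty\frac{\varphi(x^n)}{z^{n+1}}.$$ *)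

theory Defs
  imports
    "HOL-Computational_Algebra.Formal_Laurent_Series"
    "HOL-Library.Nonpos_Ints"
begin

text \<open>
  The type class \<open>ring\<close> has no unit and no commutativity; the complex scalar multiplication
  and the involution are explicit operations.
\<close>

locale complex_star_algebra = vector_space scale
  for scale :: "complex \<Rightarrow> 'a::ring \<Rightarrow> 'a" +
  fixes star :: "'a \<Rightarrow> 'a"
  assumes mult_scale_left: "scale c x * y = scale c (x * y)"
    and mult_scale_right: "x * scale c y = scale c (x * y)"
    and star_add: "star (x + y) = star x + star y"
    and star_scale: "star (scale c x) = scale (cnj c) (star x)"
    and star_mult: "star (x * y) = star y * star x"
    and star_star: "star (star x) = x"

locale cyclic_nc_prob_space = complex_star_algebra scale star
  for scale :: "complex \<Rightarrow> 'a::ring \<Rightarrow> 'a" and star :: "'a \<Rightarrow> 'a" +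
  fixes \<phi> \<omega> :: "'a \<Rightarrow> complex"
  assumes linear_\<phi>: "Vector_Spaces.linear scale (*) \<phi>"
    and positive_\<phi>: "\<phi> (star x * x) \<in> \<real>\<^sub>\<ge>\<^sub>0"
    and linear_\<omega>: "Vector_Spaces.linear scale (*) \<omega>"
    and positive_\<omega>: "\<omega> (star x * x) \<in> \<real>\<^sub>\<ge>\<^sub>0"
    and tracial_\<omega>: "\<omega> (x * y) = \<omega> (y * x)"

definition star_subalgebra ::
    "(complex \<Rightarrow> 'a::ring \<Rightarrow> 'a) \<Rightarrow> ('a \<Rightarrow> 'a) \<Rightarrow> 'a set \<Rightarrow> bool" where
  "star_subalgebra scale star S \<longleftrightarrow>
     module.subspace scale S \<and> (\<forall>x\<in>S. \<forall>y\<in>S. x * y \<in> S) \<and> (\<forall>x\<in>S. star x \<in> S)"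

text \<open>
  Product of a nonempty list, in order.  Without a unit the empty product has no meaning;
  its value here is arbitrary and the empty list is never used below.
\<close>

fun nonempty_prod :: "'a::ring list \<Rightarrow> 'a" where
  "nonempty_prod [] = 0"
| "nonempty_prod [x] = x"
| "nonempty_prod (x # y # xs) = x * nonempty_prod (y # xs)"

definition pos_power :: "'a::ring \<Rightarrow> nat \<Rightarrow> 'a" where
  "pos_power x n = nonempty_prod (replicate n x)"

text \<open>The lists \<open>ks\<close> and \<open>xs\<close> are the tuples of indices and of elements.\<close>

definition cyclic_boolean_independent ::
    "(complex \<Rightarrow> 'a::ring \<Rightarrow> 'a) \<Rightarrow> ('a \<Rightarrow> 'a) \<Rightarrow> ('a \<Rightarrow> complex) \<Rightarrow> ('a \<Rightarrow> complex) \<Rightarrow>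
     'k set \<Rightarrow> ('k \<Rightarrow> 'a set) \<Rightarrow> bool" where
  "cyclic_boolean_independent scale star \<phi> \<omega> K A \<longleftrightarrow>
     (\<forall>k\<in>K. star_subalgebra scale star (A k)) \<and>
     (\<forall>ks xs. 2 \<le> length ks \<and> set ks \<subseteq> K \<and> distinct_adj ks \<and>
        list_all2 (\<lambda>k x. x \<in> A k) ks xs \<longrightarrow>
        \<phi> (nonempty_prod xs) = prod_list (map \<phi> xs)) \<and>
     (\<forall>ks xs. 2 \<le> length ks \<and> set ks \<subseteq> K \<and> distinct_adj ks \<and> last ks \<noteq> hd ks \<and>
        list_all2 (\<lambda>k x. x \<in> A k) ks xs \<longrightarrow>
        \<omega> (nonempty_prod xs) = prod_list (map \<phi> xs))"

definition cyclic_boolean_independent_elements ::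
    "(complex \<Rightarrow> 'a::ring \<Rightarrow> 'a) \<Rightarrow> ('a \<Rightarrow> 'a) \<Rightarrow> ('a \<Rightarrow> complex) \<Rightarrow> ('a \<Rightarrow> complex) \<Rightarrow>
     'k set \<Rightarrow> ('k \<Rightarrow> 'a) \<Rightarrow> bool" where
  "cyclic_boolean_independent_elements scale star \<phi> \<omega> K a \<longleftrightarrow>
     cyclic_boolean_independent scale star \<phi> \<omega> K (\<lambda>k. star_subalgebra scale star hull {a k})"

text \<open>
  A formal Laurent series in \<open>1/z\<close> is an element of \<open>complex fls\<close> in which the formal variable
  \<open>fls_X\<close> stands for \<open>1/z\<close>, so \<open>fls_X_inv\<close> stands for \<open>z\<close>.
\<close>

definition renormalized_cauchy :: "('a::ring \<Rightarrow> complex) \<Rightarrow> 'a \<Rightarrow> complex fls" where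
  "renormalized_cauchy \<omega> x =
     fps_to_fls (Abs_fps (\<lambda>m. if m < 2 then 0 else \<omega> (pos_power x (m - 1))))"

definition green :: "('a::ring \<Rightarrow> complex) \<Rightarrow> 'a \<Rightarrow> complex fls" where
  "green \<phi> x =
     fls_X + fps_to_fls (Abs_fps (\<lambda>m. if m < 2 then 0 else \<phi> (pos_power x (m - 1))))"

text \<open>
  The derivative with respect to \<open>z\<close>: for \<open>w = 1/z\<close> the chain rule gives
  \<open>d/dz = - w\<^sup>2 d/dw\<close>, and \<open>fls_deriv\<close> is \<open>d/dw\<close>.
\<close>

definition deriv_z :: "complex fls \<Rightarrow> complex fls" where
  "deriv_z f = - (fls_X ^ 2 * fls_deriv f)"

text \<open>
  The formal logarithm of a series in nonnegative powers of \<open>1/z\<close> with constant coefficient 1: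
  \<open>fps_ln 1\<close> is the power series of \<open>log (1 + X)\<close>, and \<open>fls_regpart\<close> turns \<open>f\<close> into a power
  series without loss, as \<open>f\<close> has no positive powers of \<open>z\<close>.
\<close>

definition formal_log :: "complex fls \<Rightarrow> complex fls" where
  "formal_log f = fps_to_fls (fps_compose (fps_ln 1) (fls_regpart f - 1))"

definition h_transform ::
    "('a::ring \<Rightarrow> complex) \<Rightarrow> ('a \<Rightarrow> complex) \<Rightarrow> 'a \<Rightarrow> complex fls" where
  "h_transform \<phi> \<omega> x =
     renormalized_cauchy \<omega> x + deriv_z (formal_log (fls_X_inv * green \<phi> x))"

end

theory Submission
  imports Defs
begin

text \<open>
  Write \<open>w = 1/z\<close> and let \<open>P = \<Sum>\<^sub>n\<^sub>\<ge>\<^sub>1 \<phi>(a\<^sup>n) w\<^sup>n\<close> and \<open>Q = \<Sum>\<^sub>n\<^sub>\<ge>\<^sub>1 \<phi>(b\<^sup>n) w\<^sup>n\<close>.  Expand \<open>(a + b)\<^sup>n\<close> into words in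
  \<open>a\<close> and \<open>b\<close> and split each word into its maximal runs.  Under \<open>\<phi>\<close> every run contributes its own
  moment, and summing over the alternating sequences of runs gives
  \<open>1 + \<Sum>\<^sub>n\<^sub>\<ge>\<^sub>1 \<phi>((a + b)\<^sup>n) w\<^sup>n = (1 + P) (1 + Q) / (1 - P Q)\<close>.

  Under the trace \<open>\<omega>\<close> a word that contains both letters is to be read cyclically.  If its first
  letter is \<open>a\<close>, then the cyclic run of \<open>a\<close> through the first position has some length \<open>m\<close>, there are
  \<open>m\<close> ways to place the first position in it, and what remains is a linear word that begins and ends
  with \<open>b\<close>.  The factor \<open>m\<close> turns \<open>P\<close> into \<open>w P'\<close>, and words that begin and end with \<open>b\<close> have the
  \<open>\<phi>\<close>-series \<open>Q / (1 - P Q)\<close>.  Together with the symmetric case, the mixed words contribute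
  \<open>w (P' Q + P Q') / (1 - P Q)\<close>, which is \<open>w d/dw\<close> of \<open>- log (1 - P Q)\<close>.  By the formula for \<open>\<phi>\<close> this
  is also \<open>w d/dw\<close> of the amount by which \<open>log (z G(z))\<close> for \<open>a + b\<close> exceeds the sum of those for \<open>a\<close> and
  \<open>b\<close>, and since \<open>d/dz = - w\<^sup>2 d/dw\<close> the two defects cancel in \<open>h_transform\<close>.

  Words are never enumerated: their decompositions into runs are identities between formal power
  series with coefficients in the non-commutative algebra itself (\<open>word_decomposition\<close>), to which \<open>\<phi>\<close> and
  \<open>\<omega>\<close> are applied coefficient by coefficient (\<open>functionals_on_starting_words\<close>).  Independence is used
  only for one or two factors in front of, or one behind, an element of the span of the alternating
  products that begin and end with the same index.
\<close>

section \<open>Generating series of words\<close>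

text \<open>
  The algebra has no unit, hence neither have the series over it.  Geometric series therefore start
  with exponent 1, and \<open>linear_term x\<close> stands for \<open>x w\<close>, which is not a product.
\<close>

definition power_series :: "'a::ring \<Rightarrow> 'a fps" where
  "power_series x = Abs_fps (pos_power x)"

definition linear_term :: "'a::ring \<Rightarrow> 'a fps" where
  "linear_term x = Abs_fps (\<lambda>n. if n = 1 then x else 0)"

text \<open>
  For \<open>s = a + b\<close> and \<open>x\<close> one of \<open>a\<close>, \<open>b\<close>, the coefficient of \<open>w\<^sup>n\<close> is \<open>x (a + b)\<^sup>n\<^sup>-\<^sup>1\<close> (read as \<open>x\<close> for \<open>n = 1\<close>), the sum of all
  words of length \<open>n\<close> in \<open>a\<close> and \<open>b\<close> that begin with \<open>x\<close>.
\<close>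

definition starting_words :: "'a::ring \<Rightarrow> 'a \<Rightarrow> 'a fps" where
  "starting_words x s = linear_term x + linear_term x * power_series s"

lemma pos_power_0 [simp]: "pos_power x 0 = 0"
  and pos_power_1 [simp]: "pos_power x (Suc 0) = x"
  and pos_power_Suc_Suc: "pos_power x (Suc (Suc n)) = x * pos_power x (Suc n)"
  by (simp_all add: pos_power_def)

lemma pos_power_add:
  "0 < m \<Longrightarrow> 0 < n \<Longrightarrow> pos_power x m * pos_power x n = pos_power x (m + n)"
proof (induction m)
  case (Suc m)
  then show ?case
    by (cases m; cases n) (simp_all add: pos_power_Suc_Suc mult.assoc)
qed simp

lemma power_series_nth [simp]: "power_series x $ n = pos_power x n"
  by (simp add: power_series_def)

lemma linear_term_nth [simp]: "linear_term x $ n = (if n = 1 then x else 0)"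
  by (simp add: linear_term_def)

lemma linear_term_mult_nth:
  "(linear_term x * F) $ n = (case n of 0 \<Rightarrow> 0 | Suc m \<Rightarrow> x * F $ m)"
proof (cases n)
  case (Suc m)
  have "(linear_term x * F) $ n = (\<Sum>i=0..n. if i = 1 then x * F $ (n - 1) else 0)"
    unfolding fps_mult_nth by (rule sum.cong) auto
  with Suc show ?thesis by simp
qed simp

lemma mult_linear_term_nth:
  "(F * linear_term x) $ n = (case n of 0 \<Rightarrow> 0 | Suc m \<Rightarrow> F $ m * x)"
proof (cases n)
  case (Suc m)
  have "(F * linear_term x) $ n = (\<Sum>i=0..n. if i = m then F $ m * x else 0)"
    unfolding fps_mult_nth using Suc by (intro sum.cong) auto
  with Suc show ?thesis by simp
qed simp

lemma power_series_unfold_left: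
  "power_series x = linear_term x + linear_term x * power_series x"
proof (rule fps_ext)
  fix n show "power_series x $ n = (linear_term x + linear_term x * power_series x) $ n"
    by (cases n rule: nat.exhaust; cases "n - 1")
       (auto simp: linear_term_mult_nth pos_power_Suc_Suc)
qed

lemma power_series_unfold_right:
  "power_series x = linear_term x + power_series x * linear_term x"
proof (rule fps_ext)
  fix n show "power_series x $ n = (linear_term x + power_series x * linear_term x) $ n"
  proof (cases "n \<le> 1")
    case False
    then obtain m where n: "n = Suc (Suc m)"
      by (metis One_nat_def le_SucI le_zero_eq nat_le_linear not0_implies_Suc not_less_eq_eq)
    then show ?thesis
      using pos_power_add[of "Suc m" 1 x] by (simp add: mult_linear_term_nth)
  qed (auto simp: mult_linear_term_nth le_Suc_eq)
qed

lemma power_series_add: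
  "power_series (a + b) = starting_words a (a + b) + starting_words b (a + b)"
proof -
  have "linear_term (a + b) = linear_term a + linear_term b"
    by (rule fps_ext) simp
  then show ?thesis
    using power_series_unfold_left[of "a + b"]
    by (simp add: starting_words_def algebra_simps)
qed

text \<open>
  A word that begins with \<open>a\<close> is a run of \<open>a\<close>, either alone or followed by a word that begins with \<open>b\<close>.
  Algebraically, \<open>(1 - a w) W\<^sub>a = a w + a w W\<^sub>b\<close> is multiplied from the left by \<open>(1 - a w)\<^sup>-\<^sup>1\<close>, that is,
  by 1 plus the power series of \<open>a\<close>; the 1 has to be carried along as a separate summand.
\<close>

lemma starting_words_run:
  assumes s: "s = a + b"
  shows "starting_words a s = power_series a + power_series a * starting_words b s"
proof -
  let ?L = "linear_term a" and ?X = "power_series a"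
  let ?Wa = "starting_words a s" and ?Wb = "starting_words b s"
  have X: "?L + ?X * ?L = ?X"
    by (rule power_series_unfold_right[symmetric])
  have Wa: "?Wa = ?L + ?L * ?Wa + ?L * ?Wb"
    unfolding s by (subst starting_words_def, subst power_series_add) (simp add: distrib_left)
  then have "?X * ?Wa = ?X * (?L + ?L * ?Wa + ?L * ?Wb)"
    by (rule arg_cong)
  then have "?Wa + ?X * ?Wa = (?L + ?L * ?Wa + ?L * ?Wb) + ?X * (?L + ?L * ?Wa + ?L * ?Wb)"
    using Wa by (rule arg_cong2[where f = "(+)", rotated])
  also have "\<dots> = (?L + ?X * ?L) + (?L + ?X * ?L) * ?Wa + (?L + ?X * ?L) * ?Wb"
    by (simp add: algebra_simps)
  also have "\<dots> = ?X + ?X * ?Wa + ?X * ?Wb"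
    by (simp only: X)
  finally show ?thesis by simp
qed

text \<open>
  Here \<open>U\<close> collects the words that begin and end with \<open>b\<close>.  Such a word is a single run of \<open>b\<close>, or
  a run of \<open>b\<close>, a run of \<open>a\<close> and a shorter word of the same kind.  Words that begin with \<open>b\<close>
  are these, with or without a final run of \<open>a\<close>; words that begin with \<open>a\<close> are powers of \<open>a\<close>, or consist of an
  element of \<open>U\<close> with a run of \<open>a\<close> in front and possibly one behind.
\<close>

lemma word_decomposition:
  fixes a b :: "'a::ring"
  obtains U where
    "U = power_series b + power_series b * (power_series a * U)"
    "starting_words b (a + b) = U + U * power_series a"
    "starting_words a (a + b)
       = power_series a + power_series a * U + power_series a * (U * power_series a)"
proof -
  let ?L = "linear_term a" and ?X = "power_series a" and ?Y = "power_series b"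
  let ?Wa = "starting_words a (a + b)" and ?Wb = "starting_words b (a + b)"
  \<comment> \<open>From all words that begin with \<open>b\<close>, remove those whose last letter is \<open>a\<close>.\<close>
  define U where "U = ?Wb - ?Wb * ?L"
  have X: "?X = ?L + ?L * ?X" by (rule power_series_unfold_left)
  have X': "?X = ?L + ?X * ?L" by (rule power_series_unfold_right)
  have Wa: "?Wa = ?X + ?X * ?Wb" by (rule starting_words_run) simp
  have Wb: "?Wb = ?Y + ?Y * ?Wa" by (rule starting_words_run) (simp add: add.commute)
  have "U + U * ?X = ?Wb + ?Wb * ?X - ?Wb * (?L + ?L * ?X)"
    by (simp add: U_def algebra_simps)
  then have 2: "?Wb = U + U * ?X"
    by (simp flip: X)
  have Wb': "?Wb = ?Y + ?Y * ?X + ?Y * (?X * ?Wb)"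
    using Wb by (subst (asm) Wa) (simp add: algebra_simps)
  have "U = ?Y + ?Y * ?X + ?Y * (?X * ?Wb) - (?Y + ?Y * ?X + ?Y * (?X * ?Wb)) * ?L"
    unfolding U_def by (simp flip: Wb')
  also have "\<dots> = ?Y + ?Y * (?X - (?L + ?X * ?L)) + ?Y * (?X * U)"
    by (simp add: U_def algebra_simps)
  also have "\<dots> = ?Y + ?Y * (?X * U)"
    by (simp flip: X')
  finally have 1: "U = ?Y + ?Y * (?X * U)" .
  have "?Wa = ?X + ?X * (U + U * ?X)"
    using Wa by (simp flip: 2)
  then have 3: "?Wa = ?X + ?X * U + ?X * (U * ?X)"
    by (simp add: algebra_simps)
  show thesis using that 1 2 3 .
qed

section \<open>Functionals applied coefficientwise\<close>

definition coeffwise :: "('a::zero \<Rightarrow> 'b::zero) \<Rightarrow> 'a fps \<Rightarrow> 'b fps" where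
  "coeffwise f F = Abs_fps (\<lambda>n. f (F $ n))"

lemma coeffwise_nth [simp]: "coeffwise f F $ n = f (F $ n)"
  by (simp add: coeffwise_def)

lemma coeffwise_add: "additive f \<Longrightarrow> coeffwise f (F + G) = coeffwise f F + coeffwise f G"
  by (rule fps_ext) (simp add: additive.add)

lemma coeffwise_mult:
  fixes f :: "'a::ring \<Rightarrow> 'b::ring"
  assumes "additive f" and "\<And>i j. f (F $ i * G $ j) = g (F $ i) * h (G $ j)"
  shows "coeffwise f (F * G) = coeffwise g F * coeffwise h G"
  by (rule fps_ext) (simp add: fps_mult_nth additive.sum[OF assms(1)] assms(2))

lemma coeffwise_mult_commute:
  fixes f :: "'a::ring \<Rightarrow> 'b::ring"
  assumes "additive f" and "\<And>x y. f (x * y) = f (y * x)"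
  shows "coeffwise f (F * G) = coeffwise f (G * F)"
proof (rule fps_ext)
  fix n
  have "coeffwise f (F * G) $ n = (\<Sum>i=0..n. f (G $ (n - i) * F $ i))"
    by (simp add: fps_mult_nth additive.sum[OF assms(1)] assms(2))
  also have "\<dots> = (\<Sum>i=0..n. f (G $ i * F $ (n - i)))"
    by (subst sum.atLeastAtMost_rev) (intro sum.cong, auto)
  finally show "coeffwise f (F * G) $ n = coeffwise f (G * F) $ n"
    by (simp add: fps_mult_nth additive.sum[OF assms(1)])
qed

text \<open>
  The run \<open>x\<^sup>n\<close> splits into \<open>x\<^sup>i x\<^sup>n\<^sup>-\<^sup>i\<close> with both parts nonempty in \<open>n - 1\<close> ways, so one more copy of
  \<open>x\<^sup>n\<close> gives the factor \<open>n\<close>, which is the effect of \<open>w d/dw\<close>.  This counts the positions in a cyclic run.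
\<close>

lemma coeffwise_rotated_powers:
  fixes f :: "'a::ring \<Rightarrow> complex"
  assumes "additive f"
  shows "coeffwise f (power_series x * power_series x) + coeffwise f (power_series x)
           = fps_X * fps_deriv (coeffwise f (power_series x))"
proof (rule fps_ext)
  fix n
  have "f ((power_series x * power_series x) $ n)
      = (\<Sum>i=0..n. f (pos_power x i * pos_power x (n - i)))"
    by (simp add: fps_mult_nth additive.sum[OF assms])
  also have "\<dots> = (\<Sum>i\<in>{0<..<n}. f (pos_power x n))"
    by (rule sum.mono_neutral_cong_right)
       (auto simp: pos_power_add additive.zero[OF assms] not_less)
  also have "\<dots> = of_nat (n - 1) * f (pos_power x n)"
    by simp
  finally show "(coeffwise f (power_series x * power_series x) + coeffwise f (power_series x)) $ n
      = (fps_X * fps_deriv (coeffwise f (power_series x))) $ n"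
    by (cases n) (simp_all add: additive.zero[OF assms] algebra_simps)
qed

section \<open>Independence on alternating products\<close>

lemma nonempty_prod_Cons: "xs \<noteq> [] \<Longrightarrow> nonempty_prod (x # xs) = x * nonempty_prod xs"
  by (cases xs) auto

lemma nonempty_prod_snoc: "xs \<noteq> [] \<Longrightarrow> nonempty_prod (xs @ [x]) = nonempty_prod xs * x"
proof (induction xs)
  case (Cons y xs)
  then show ?case
    by (cases "xs = []") (simp_all add: nonempty_prod_Cons mult.assoc)
qed simp

locale cyclic_boolean_family = cyclic_nc_prob_space scale star \<phi> \<omega>
  for scale :: "complex \<Rightarrow> 'a::ring \<Rightarrow> 'a" and star :: "'a \<Rightarrow> 'a"
    and \<phi> \<omega> :: "'a \<Rightarrow> complex" +
  fixes K :: "'k set" and A :: "'k \<Rightarrow> 'a set"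
  assumes independent: "cyclic_boolean_independent scale star \<phi> \<omega> K A"
begin

lemma additive_\<phi>: "additive \<phi>" and additive_\<omega>: "additive \<omega>"
proof -
  interpret p: Vector_Spaces.linear scale "(*)" \<phi> by (rule linear_\<phi>)
  interpret o: Vector_Spaces.linear scale "(*)" \<omega> by (rule linear_\<omega>)
  show "additive \<phi>" "additive \<omega>"
    by (simp_all add: additive_def p.add o.add)
qed

lemma \<phi>_scale: "\<phi> (scale c x) = c * \<phi> x" and \<omega>_scale: "\<omega> (scale c x) = c * \<omega> x"
proof -
  interpret p: Vector_Spaces.linear scale "(*)" \<phi> by (rule linear_\<phi>)
  interpret o: Vector_Spaces.linear scale "(*)" \<omega> by (rule linear_\<omega>)
  show "\<phi> (scale c x) = c * \<phi> x" "\<omega> (scale c x) = c * \<omega> x"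
    by (simp_all add: p.scale o.scale)
qed

lemma A_closed:
  assumes "k \<in> K"
  shows "subspace (A k)" and "x \<in> A k \<Longrightarrow> y \<in> A k \<Longrightarrow> x * y \<in> A k"
  using independent assms
  by (auto simp: cyclic_boolean_independent_def star_subalgebra_def)

definition alternating :: "'k list \<Rightarrow> 'a list \<Rightarrow> bool" where
  "alternating ks xs \<longleftrightarrow>
     ks \<noteq> [] \<and> set ks \<subseteq> K \<and> distinct_adj ks \<and> list_all2 (\<lambda>k x. x \<in> A k) ks xs"

text \<open>
  Coefficients of series of words are sums of alternating products, so independence has to be
  extended by linearity; the span makes this an induction.
\<close>

definition bracketed :: "'k \<Rightarrow> 'a set" where
  "bracketed k =
     span {nonempty_prod xs | ks xs. alternating ks xs \<and> hd ks = k \<and> last ks = k}"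

lemma alternating_nonempty: "alternating ks xs \<Longrightarrow> xs \<noteq> []"
  by (auto simp: alternating_def)

lemma \<phi>_alternating:
  assumes "alternating ks xs"
  shows "\<phi> (nonempty_prod xs) = prod_list (map \<phi> xs)"
proof (cases "length ks \<ge> 2")
  case True
  with assms independent show ?thesis
    unfolding cyclic_boolean_independent_def alternating_def by blast
next
  case False
  with assms have "length xs = 1"
    by (metis One_nat_def Suc_1 alternating_def length_0_conv less_2_cases list_all2_lengthD
        not_less)
  then obtain x where "xs = [x]"
    by (auto simp: length_Suc_conv)
  then show ?thesis by simp
qed

lemma \<omega>_alternating:
  assumes "alternating ks xs" "last ks \<noteq> hd ks"
  shows "\<omega> (nonempty_prod xs) = prod_list (map \<phi> xs)"
proof -
  have "length ks \<ge> 2"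
    using assms by (cases ks; cases "tl ks") (auto simp: alternating_def)
  with assms independent show ?thesis
    unfolding cyclic_boolean_independent_def alternating_def by blast
qed

lemma alternating_Cons:
  assumes "alternating ks xs" "l \<in> K" "x \<in> A l" "l \<noteq> hd ks"
  shows "alternating (l # ks) (x # xs)"
  using assms by (auto simp: alternating_def distinct_adj_Cons)

lemma alternating_snoc:
  assumes "alternating ks xs" "l \<in> K" "x \<in> A l" "l \<noteq> last ks"
  shows "alternating (ks @ [l]) (xs @ [x])"
  using assms by (auto simp: alternating_def distinct_adj_append_iff intro!: list_all2_appendI)

lemma bracketed_induct [consumes 1, case_names zero add scale product]:
  assumes "u \<in> bracketed k"
    and "P 0" and "\<And>u v. P u \<Longrightarrow> P v \<Longrightarrow> P (u + v)" and "\<And>c u. P u \<Longrightarrow> P (scale c u)"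
    and "\<And>ks xs. alternating ks xs \<Longrightarrow> hd ks = k \<Longrightarrow> last ks = k \<Longrightarrow> P (nonempty_prod xs)"
  shows "P u"
proof -
  have "u \<in> {u. P u}"
    using assms(1) unfolding bracketed_def
    by (rule span_induct) (auto intro: assms(2-) subspaceI)
  then show ?thesis by simp
qed

lemma alternating_product_in_bracketed:
  "alternating ks xs \<Longrightarrow> hd ks = k \<Longrightarrow> last ks = k \<Longrightarrow> nonempty_prod xs \<in> bracketed k"
  unfolding bracketed_def by (rule span_base) blast

lemma A_subset_bracketed:
  assumes "k \<in> K" "y \<in> A k"
  shows "y \<in> bracketed k"
  using alternating_product_in_bracketed[of "[k]" "[y]" k] assms by (simp add: alternating_def)

context
  fixes k l x u
  assumes kl: "k \<in> K" "l \<in> K" "k \<noteq> l" and x: "x \<in> A l" and u: "u \<in> bracketed k"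
begin

lemma bracketed_extend:
  assumes "y \<in> A k"
  shows "y * (x * u) \<in> bracketed k"
  using u
proof (induction rule: bracketed_induct)
  case (product ks xs)
  then have "alternating (k # l # ks) (y # x # xs)"
    using kl x assms by (intro alternating_Cons) auto
  moreover have "ks \<noteq> []"
    using product by (simp add: alternating_def)
  ultimately have "nonempty_prod (y # x # xs) \<in> bracketed k"
    using product by (intro alternating_product_in_bracketed[of "k # l # ks"]) auto
  then show ?case
    using product by (simp add: nonempty_prod_Cons alternating_nonempty)
qed (auto simp: bracketed_def distrib_left mult_scale_right
       intro: span_zero span_add span_scale)

text \<open>
  Each identity is linear in \<open>u\<close>, so it suffices to take for \<open>u\<close> an alternating product whose first and
  last index is \<open>k\<close>.  A factor of index \<open>l\<close> then keeps it alternating on either side; placed in front it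
  also makes the first and last index different, which is what \<open>\<omega>\<close> requires.
\<close>

lemma \<phi>_extend_left: "\<phi> (x * u) = \<phi> x * \<phi> u"
  and \<phi>_extend_right: "\<phi> (u * x) = \<phi> u * \<phi> x"
  and \<omega>_extend_left: "\<omega> (x * u) = \<phi> x * \<phi> u"
proof -
  have "\<phi> (x * u) = \<phi> x * \<phi> u \<and> \<phi> (u * x) = \<phi> u * \<phi> x \<and> \<omega> (x * u) = \<phi> x * \<phi> u"
    using u
  proof (induction rule: bracketed_induct)
    case (product ks xs)
    note ne = alternating_nonempty[OF product(1)]
    have l: "alternating (l # ks) (x # xs)" and r: "alternating (ks @ [l]) (xs @ [x])"
      using product kl x by (auto intro: alternating_Cons alternating_snoc)
    have "last (l # ks) \<noteq> hd (l # ks)"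
      using product kl by (auto simp: alternating_def)
    with \<phi>_alternating[OF l] \<phi>_alternating[OF r] \<omega>_alternating[OF l] \<phi>_alternating[OF product(1)]
    show ?case
      by (simp add: nonempty_prod_Cons nonempty_prod_snoc ne)
  qed (auto simp: additive.zero[OF additive_\<phi>] additive.zero[OF additive_\<omega>]
       additive.add[OF additive_\<phi>] additive.add[OF additive_\<omega>]
       algebra_simps mult_scale_left mult_scale_right \<phi>_scale \<omega>_scale)
  then show "\<phi> (x * u) = \<phi> x * \<phi> u" "\<phi> (u * x) = \<phi> u * \<phi> x" "\<omega> (x * u) = \<phi> x * \<phi> u"
    by auto
qed

lemma \<phi>_extend_left_twice:
  assumes y: "y \<in> A k"
  shows "\<phi> (y * (x * u)) = \<phi> y * (\<phi> x * \<phi> u)"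
  using u
proof (induction rule: bracketed_induct)
  case (product ks xs)
  note ne = alternating_nonempty[OF product(1)]
  have "alternating (k # l # ks) (y # x # xs)"
    using product kl x y by (intro alternating_Cons) auto
  from \<phi>_alternating[OF this] \<phi>_alternating[OF product(1)] show ?case
    by (simp add: nonempty_prod_Cons ne)
qed (auto simp: additive.zero[OF additive_\<phi>] additive.add[OF additive_\<phi>]
     algebra_simps mult_scale_right \<phi>_scale)

end

lemma pos_power_in_A: "k \<in> K \<Longrightarrow> a \<in> A k \<Longrightarrow> pos_power a n \<in> A k"
proof (induction n)
  case 0
  then show ?case by (simp add: subspace_0 A_closed)
next
  case (Suc n)
  then show ?case by (cases n) (simp_all add: A_closed pos_power_Suc_Suc)
qed

text \<open>
  The fixed-point equation removes a nonempty run of \<open>b\<close> from the front, so the coefficient of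
  \<open>w\<^sup>n\<close> is expressed by coefficients of \<open>U\<close> with smaller exponents.
\<close>

lemma bracketed_series:
  assumes kl: "k \<in> K" "l \<in> K" "k \<noteq> l" and ab: "b \<in> A k" "a \<in> A l"
    and U: "U = power_series b + power_series b * (power_series a * U)"
  shows "U $ n \<in> bracketed k"
proof (induction n rule: less_induct)
  case (less n)
  let ?X = "power_series a" and ?Y = "power_series b"
  have "?Y $ i * (?X * U) $ (n - i) \<in> bracketed k" for i
  proof (cases "i = 0 \<or> i > n")
    case True
    then show ?thesis
      by (auto simp: bracketed_def intro: span_zero)
  next
    case False
    have "?Y $ i * (?X * U) $ (n - i) =
        (\<Sum>j=0..n - i. ?Y $ i * (?X $ j * U $ (n - i - j)))"
      by (simp only: fps_mult_nth sum_distrib_left)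
    also have "\<dots> \<in> bracketed k"
      unfolding bracketed_def
    proof (rule span_sum)
      fix j assume "j \<in> {0..n - i}"
      then have "U $ (n - i - j) \<in> bracketed k"
        using False by (intro less) auto
      then show "?Y $ i * (?X $ j * U $ (n - i - j)) \<in>
          span {nonempty_prod xs | ks xs. alternating ks xs \<and> hd ks = k \<and> last ks = k}"
        using bracketed_extend[OF kl, of "?X $ j" "U $ (n - i - j)" "?Y $ i"] kl ab
        by (simp add: pos_power_in_A bracketed_def)
    qed
    finally show ?thesis .
  qed
  then have "(\<Sum>i=0..n. ?Y $ i * (?X * U) $ (n - i)) \<in> bracketed k"
    unfolding bracketed_def by (intro span_sum)
  moreover have "?Y $ n \<in> bracketed k"
    using kl ab by (simp add: A_subset_bracketed pos_power_in_A)
  ultimately have "?Y $ n + (\<Sum>i=0..n. ?Y $ i * (?X * U) $ (n - i)) \<in> bracketed k"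
    unfolding bracketed_def by (rule span_add[rotated])
  also have "?Y $ n + (\<Sum>i=0..n. ?Y $ i * (?X * U) $ (n - i)) = U $ n"
    using arg_cong[OF U, of "\<lambda>F. F $ n"] by (simp add: fps_mult_nth[of ?Y])
  finally show ?case .
qed

text \<open>
  The second identity is where the trace enters: in \<open>\<omega>(a\<^sup>i u a\<^sup>j) = \<omega>(a\<^sup>j\<^sup>+\<^sup>i u)\<close> the two outer runs
  merge to a single factor from the algebra of \<open>a\<close>, and the resulting product is cyclically alternating.
  Summation over \<open>i\<close> and \<open>j\<close>, the case without a final run included, yields \<open>w P'\<close>.
\<close>

lemma functionals_on_starting_words:
  assumes kl: "k \<in> K" "l \<in> K" "k \<noteq> l" and ab: "b \<in> A k" "a \<in> A l"
  defines "P \<equiv> coeffwise \<phi> (power_series a)" and "Q \<equiv> coeffwise \<phi> (power_series b)"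
  shows "(1 - P * Q) * coeffwise \<phi> (starting_words b (a + b)) = Q * (1 + P)"
    and "(1 - P * Q) * coeffwise \<omega> (starting_words a (a + b))
           = (1 - P * Q) * coeffwise \<omega> (power_series a) + fps_X * fps_deriv P * Q"
proof -
  let ?X = "power_series a" and ?Y = "power_series b"
  obtain U where U: "U = ?Y + ?Y * (?X * U)"
    and Wb: "starting_words b (a + b) = U + U * ?X"
    and Wa: "starting_words a (a + b) = ?X + ?X * U + ?X * (U * ?X)"
    by (rule word_decomposition)
  define V where "V = coeffwise \<phi> U"
  have brU: "U $ n \<in> bracketed k" for n
    by (rule bracketed_series[OF kl ab U])
  have X: "?X $ n \<in> A l" and Y: "?Y $ n \<in> A k" for n
    using kl ab by (simp_all add: pos_power_in_A)
  have XX: "(?X * ?X) $ n \<in> A l" for n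
    unfolding fps_mult_nth using kl X by (intro subspace_sum) (auto simp: A_closed)
  have "coeffwise \<phi> (?Y * (?X * U)) = Q * (P * V)"
  proof (rule fps_ext)
    fix n
    show "coeffwise \<phi> (?Y * (?X * U)) $ n = (Q * (P * V)) $ n"
      using \<phi>_extend_left_twice[OF kl X brU Y]
      by (simp add: P_def Q_def V_def fps_mult_nth sum_distrib_left
          additive.sum[OF additive_\<phi>])
  qed
  then have V: "V = Q + Q * (P * V)"
    unfolding V_def Q_def by (subst U) (simp add: coeffwise_add[OF additive_\<phi>])
  then have V': "(1 - P * Q) * V = Q"
    by (simp add: algebra_simps)
  have "coeffwise \<phi> (U * ?X) = V * P"
    unfolding V_def P_def by (intro coeffwise_mult additive_\<phi> \<phi>_extend_right[OF kl X brU])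
  then have "coeffwise \<phi> (starting_words b (a + b)) = V * (1 + P)"
    by (simp add: Wb coeffwise_add[OF additive_\<phi>] V_def algebra_simps)
  with V' show "(1 - P * Q) * coeffwise \<phi> (starting_words b (a + b)) = Q * (1 + P)"
    by (simp add: mult.assoc[symmetric])
  have "coeffwise \<omega> (?X * (U * ?X)) = coeffwise \<omega> ((?X * ?X) * U)"
    using coeffwise_mult_commute[OF additive_\<omega> tracial_\<omega>, of "?X * U" ?X]
    by (simp add: mult.assoc)
  also have "\<dots> = coeffwise \<phi> (?X * ?X) * V"
    unfolding V_def by (intro coeffwise_mult additive_\<omega> \<omega>_extend_left[OF kl XX brU])
  finally have XUX: "coeffwise \<omega> (?X * (U * ?X)) = coeffwise \<phi> (?X * ?X) * V" .
  have "coeffwise \<omega> (?X * U) = P * V"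
    unfolding P_def V_def by (intro coeffwise_mult additive_\<omega> \<omega>_extend_left[OF kl X brU])
  then have "coeffwise \<omega> (starting_words a (a + b))
      = coeffwise \<omega> ?X + (coeffwise \<phi> (?X * ?X) + P) * V"
    by (simp add: Wa coeffwise_add[OF additive_\<omega>] XUX algebra_simps)
  also have "coeffwise \<phi> (?X * ?X) + P = fps_X * fps_deriv P"
    unfolding P_def by (rule coeffwise_rotated_powers[OF additive_\<phi>])
  finally show "(1 - P * Q) * coeffwise \<omega> (starting_words a (a + b))
           = (1 - P * Q) * coeffwise \<omega> ?X + fps_X * fps_deriv P * Q"
    by (simp add: distrib_left mult.left_commute[of _ "fps_X * fps_deriv P"] V')
qed

text \<open>
  Every word begins with \<open>a\<close> or with \<open>b\<close>, and exchanging the two letters exchanges \<open>P\<close> and \<open>Q\<close>.  The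
  contributions \<open>w P' Q\<close> and \<open>w P Q'\<close> of the mixed words then combine to \<open>w (P Q)'\<close>.
\<close>

lemma functionals_on_power_series_add:
  assumes kl: "k \<in> K" "l \<in> K" "k \<noteq> l" and ab: "a \<in> A k" "b \<in> A l"
  defines "P \<equiv> coeffwise \<phi> (power_series a)" and "Q \<equiv> coeffwise \<phi> (power_series b)"
  shows "(1 - P * Q) * (1 + coeffwise \<phi> (power_series (a + b))) = (1 + P) * (1 + Q)"
    and "(1 - P * Q) * coeffwise \<omega> (power_series (a + b))
           = (1 - P * Q) * (coeffwise \<omega> (power_series a) + coeffwise \<omega> (power_series b))
             + fps_X * fps_deriv (P * Q)"
proof -
  note 1 = functionals_on_starting_words[OF kl ab(1) ab(2)]
  note 2 = functionals_on_starting_words[OF kl(2,1) kl(3)[symmetric] ab(2) ab(1)]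
  note simps = 1[unfolded add.commute[of b a], folded P_def Q_def] 2[folded P_def Q_def]
  show "(1 - P * Q) * (1 + coeffwise \<phi> (power_series (a + b))) = (1 + P) * (1 + Q)"
    using simps(1,3)
    by (simp add: power_series_add coeffwise_add[OF additive_\<phi>] distrib_left mult.commute[of Q P])
      (simp add: algebra_simps)
  show "(1 - P * Q) * coeffwise \<omega> (power_series (a + b))
           = (1 - P * Q) * (coeffwise \<omega> (power_series a) + coeffwise \<omega> (power_series b))
             + fps_X * fps_deriv (P * Q)"
    using simps(2,4)
    by (simp add: power_series_add coeffwise_add[OF additive_\<omega>] algebra_simps)
qed

end

section \<open>Passage to Laurent series\<close>

text \<open>
  The series of \<open>z G(z)\<close>; its constant term 1 takes the place of the value of \<open>\<phi>\<close> at a unit.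
\<close>

definition moment_series :: "('a::ring \<Rightarrow> complex) \<Rightarrow> 'a \<Rightarrow> complex fps" where
  "moment_series \<phi> x = Abs_fps (\<lambda>n. if n = 0 then 1 else \<phi> (pos_power x n))"

lemma moment_series_nth_0 [simp]: "moment_series \<phi> x $ 0 = 1"
  by (simp add: moment_series_def)

lemma moment_series_eq: "additive \<phi> \<Longrightarrow> moment_series \<phi> x = 1 + coeffwise \<phi> (power_series x)"
  by (rule fps_ext) (simp add: moment_series_def additive.zero)

lemma green_eq: "green \<phi> x = fls_X * fps_to_fls (moment_series \<phi> x)"
proof -
  have "fps_X + Abs_fps (\<lambda>m. if m < 2 then 0 else \<phi> (pos_power x (m - 1)))
      = fps_X * moment_series \<phi> x"
    by (rule fps_ext) (auto simp: moment_series_def)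
  from arg_cong[OF this, of fps_to_fls] show ?thesis
    by (simp add: green_def fls_times_fps_to_fls)
qed

lemma renormalized_cauchy_eq:
  assumes "additive \<omega>"
  shows "renormalized_cauchy \<omega> x = fls_X * fps_to_fls (coeffwise \<omega> (power_series x))"
proof -
  have "Abs_fps (\<lambda>m. if m < 2 then 0 else \<omega> (pos_power x (m - 1)))
      = fps_X * coeffwise \<omega> (power_series x)"
  proof (rule fps_ext)
    fix n
    show "Abs_fps (\<lambda>m. if m < 2 then 0 else \<omega> (pos_power x (m - 1))) $ n
      = (fps_X * coeffwise \<omega> (power_series x)) $ n"
      by (cases "n = 1") (auto simp: additive.zero[OF assms])
  qed
  then show ?thesis
    by (simp add: renormalized_cauchy_def fls_times_fps_to_fls)
qed

lemma deriv_z_formal_log: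
  assumes "M $ 0 = 1"
  shows "deriv_z (formal_log (fps_to_fls M))
           = - (fls_X ^ 2 * (fps_to_fls (fps_deriv M) / fps_to_fls M))"
proof -
  have 0: "(M - 1) $ 0 = 0" using assms by simp
  have "fps_deriv (fps_ln 1 oo (M - 1)) = (inverse (1 + fps_X) oo (M - 1)) * fps_deriv M"
    by (simp add: fps_compose_deriv[OF 0] fps_ln_deriv)
  also have "inverse (1 + fps_X) oo (M - 1) = inverse M"
    using fps_inverse_compose[OF 0, of "1 + fps_X"] 0
    by (simp add: fps_compose_add_distrib)
  finally have *: "fps_deriv (fps_ln 1 oo (M - 1)) = inverse M * fps_deriv M" .
  have "fps_to_fls (inverse M) * fps_to_fls M = 1"
    using inverse_mult_eq_1[of M] assms by (simp flip: fls_times_fps_to_fls)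
  then have "fps_to_fls (inverse M) = inverse (fps_to_fls M)"
    by (metis inverse_unique mult.commute)
  then show ?thesis
    by (simp add: deriv_z_def formal_log_def fls_deriv_fps_to_fls * fls_times_fps_to_fls
        divide_inverse mult.commute)
qed

lemma log_deriv_green:
  "deriv_z (green \<phi> x) / green \<phi> x = deriv_z (formal_log (fls_X_inv * green \<phi> x)) - fls_X"
proof -
  define M where "M = moment_series \<phi> x"
  have M0: "M $ 0 = 1" by (simp add: M_def)
  then have "M \<noteq> 0" by auto
  then have M: "fps_to_fls M \<noteq> 0" by simp
  have X: "fls_X_inv * fls_X = (1 :: complex fls)"
    by (metis fls_inverse_X left_inverse fls_X_nonzero)
  have g: "green \<phi> x = fls_X * fps_to_fls M"
    by (simp add: green_eq M_def)
  then have "fls_X_inv * green \<phi> x = fps_to_fls M"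
    using X by (simp add: mult.assoc[symmetric])
  moreover have "deriv_z (green \<phi> x) / green \<phi> x =
      - (fls_X ^ 2 * (fps_to_fls (fps_deriv M) / fps_to_fls M)) - fls_X"
    using M unfolding g deriv_z_def
    by (simp add: fls_deriv_fps_to_fls field_simps power2_eq_square)
  ultimately show ?thesis
    using deriv_z_formal_log[OF M0] by simp
qed

lemma h_transform_eq:
  "h_transform \<phi> \<omega> x = renormalized_cauchy \<omega> x + fls_X + deriv_z (green \<phi> x) / green \<phi> x"
  by (simp add: h_transform_def log_deriv_green)

text \<open>
  Logarithmic derivatives of the relation \<open>D R = M N\<close>, where later \<open>D = 1 - P Q\<close> and \<open>R\<close>, \<open>M\<close>, \<open>N\<close> are the
  moment series of \<open>a + b\<close>, \<open>a\<close>, \<open>b\<close>.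
\<close>

lemma log_deriv_of_product:
  fixes M N R D :: "complex fps"
  assumes "D * R = M * N" "D \<noteq> 0" "M \<noteq> 0" "N \<noteq> 0"
  shows "fps_to_fls (fps_deriv R) / fps_to_fls R =
     fps_to_fls (fps_deriv M) / fps_to_fls M + fps_to_fls (fps_deriv N) / fps_to_fls N
     - fps_to_fls (fps_deriv D) / fps_to_fls D"
proof -
  have R: "R \<noteq> 0" using assms by auto
  have e: "fps_to_fls D * fps_to_fls R = fps_to_fls M * fps_to_fls N"
    using assms(1) by (simp flip: fls_times_fps_to_fls)
  have "fps_deriv (D * R) = fps_deriv (M * N)"
    using assms(1) by simp
  then have d: "fps_to_fls D * fps_to_fls (fps_deriv R) + fps_to_fls (fps_deriv D) * fps_to_fls R
    = fps_to_fls M * fps_to_fls (fps_deriv N) + fps_to_fls (fps_deriv M) * fps_to_fls N"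
    by (simp flip: fls_times_fps_to_fls fps_to_fls_plus)
  have log_deriv_mult: "x' / x + y' / y = (x * y' + x' * y) / (x * y)"
    if "x \<noteq> 0" "y \<noteq> 0" for x y x' y' :: "complex fls"
    using that by (simp add: field_simps)
  have "fps_to_fls (fps_deriv D) / fps_to_fls D + fps_to_fls (fps_deriv R) / fps_to_fls R
    = fps_to_fls (fps_deriv M) / fps_to_fls M + fps_to_fls (fps_deriv N) / fps_to_fls N"
    using assms R by (simp add: log_deriv_mult d e)
  then show ?thesis by (simp add: algebra_simps)
qed

text \<open>
  With \<open>D = 1 - P Q\<close>, the \<open>\<omega>\<close>-series of \<open>a + b\<close> exceeds those of \<open>a\<close> and \<open>b\<close> by \<open>- w D'/D\<close>, and so does \<open>w\<close> times
  the logarithmic derivative of the moment series; \<open>h_transform\<close> is \<open>w\<close> times the difference of the two.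
\<close>

lemma (in cyclic_boolean_family) h_transform_add:
  assumes kl: "k \<in> K" "l \<in> K" "k \<noteq> l" and ab: "a \<in> A k" "b \<in> A l"
  shows "h_transform \<phi> \<omega> (a + b) = h_transform \<phi> \<omega> a + h_transform \<phi> \<omega> b"
proof -
  define P Q where "P = coeffwise \<phi> (power_series a)" and "Q = coeffwise \<phi> (power_series b)"
  define D where "D = 1 - P * Q"
  let ?\<Omega> = "\<lambda>x. fps_to_fls (coeffwise \<omega> (power_series x))"
  let ?L = "\<lambda>F. fps_to_fls (fps_deriv F) / fps_to_fls F"
  have h: "h_transform \<phi> \<omega> x = fls_X * ?\<Omega> x - fls_X ^ 2 * ?L (moment_series \<phi> x)" for x
  proof -
    have X: "fls_X_inv * fls_X = (1 :: complex fls)"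
      by (metis fls_inverse_X left_inverse fls_X_nonzero)
    show ?thesis
      by (simp add: h_transform_def renormalized_cauchy_eq[OF additive_\<omega>] green_eq
          mult.assoc[symmetric] X deriv_z_formal_log)
  qed
  have "D $ 0 = 1"
    by (simp add: D_def P_def additive.zero[OF additive_\<phi>])
  then have D: "D \<noteq> 0" by auto
  have M: "moment_series \<phi> x \<noteq> 0" for x
    by (metis fps_zero_nth moment_series_nth_0 zero_neq_one)
  have "D * moment_series \<phi> (a + b) = moment_series \<phi> a * moment_series \<phi> b"
    using functionals_on_power_series_add(1)[OF kl ab]
    by (simp add: D_def P_def Q_def moment_series_eq[OF additive_\<phi>])
  note L = log_deriv_of_product[OF this D M M]
  have "D * coeffwise \<omega> (power_series (a + b))
      = D * (coeffwise \<omega> (power_series a) + coeffwise \<omega> (power_series b)) - fps_X * fps_deriv D"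
    using functionals_on_power_series_add(2)[OF kl ab] by (simp add: D_def P_def Q_def algebra_simps)
  from arg_cong[OF this, of fps_to_fls]
  have "fps_to_fls D * ?\<Omega> (a + b) = fps_to_fls D * (?\<Omega> a + ?\<Omega> b) - fls_X * fps_to_fls (fps_deriv D)"
    by (simp add: fls_times_fps_to_fls)
  then have \<Omega>: "?\<Omega> (a + b) = ?\<Omega> a + ?\<Omega> b - fls_X * ?L D"
    using D by (simp add: field_simps)
  show ?thesis
    unfolding h L \<Omega> by (simp add: algebra_simps power2_eq_square)
qed

theorem theorem4p2:
  fixes scale :: "complex \<Rightarrow> 'a::ring \<Rightarrow> 'a"
    and star :: "'a \<Rightarrow> 'a"
    and \<phi> \<omega> :: "'a \<Rightarrow> complex"
    and a b :: 'a
  assumes "cyclic_nc_prob_space scale star \<phi> \<omega>"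
    and "cyclic_boolean_independent_elements scale star \<phi> \<omega>
           {0, 1} (\<lambda>k::nat. if k = 0 then a else b)"
  shows "renormalized_cauchy \<omega> (a + b) =
           renormalized_cauchy \<omega> a + renormalized_cauchy \<omega> b
           + deriv_z (green \<phi> a) / green \<phi> a
           + deriv_z (green \<phi> b) / green \<phi> b
           - deriv_z (green \<phi> (a + b)) / green \<phi> (a + b)
           + fls_X \<and>
         (\<forall>x. h_transform \<phi> \<omega> x =
           renormalized_cauchy \<omega> x + fls_X + deriv_z (green \<phi> x) / green \<phi> x) \<and>
         h_transform \<phi> \<omega> (a + b) = h_transform \<phi> \<omega> a + h_transform \<phi> \<omega> b"
proof -
  let ?A = "\<lambda>k::nat. star_subalgebra scale star hull {if k = 0 then a else b}"
  interpret cyclic_nc_prob_space scale star \<phi> \<omega> by (rule assms(1))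
  interpret cyclic_boolean_family scale star \<phi> \<omega> "{0, 1}" ?A
    using assms(2) by unfold_locales (simp add: cyclic_boolean_independent_elements_def)
  have "a \<in> ?A 0" "b \<in> ?A 1"
    using hull_subset[of "{a}"] hull_subset[of "{b}"] by auto
  then have "h_transform \<phi> \<omega> (a + b) = h_transform \<phi> \<omega> a + h_transform \<phi> \<omega> b"
    by (intro h_transform_add[of 0 1]) auto
  then show ?thesis
    by (simp add: h_transform_eq algebra_simps)
qed

end
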